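(* For every integer $n\ge 1$, \[|J(P_n(\{b,g\}))|=|J(P_n(\{r,g\}))|=C_n=\frac{1}{n+1}\binom{2n}{n},\] and \[F(J(P_n(\{b,g\})),q)=F(J(P_n(\{r,g\})^* ),q)=C_n(q),\] where $C_n(q)$ is the Carlitz–Riordan $q$-Catalan number, defined by $C_0(q)=C_1(q)=1$ and $C_m(q)=\sum_{k=1}^{m}q^{k-1}C_{k-1}(q)C_{m-k}(q)$ for $m\ge 2$.
   Context: For an integer $n\ge 1$, let $P_n$ be the set of pairs $(c_1,c_2)$ of nonnegative integers with $c_1+c_2\le n-2$. Associate to the colors red, green, blue the vectors $r=(1,0)$, $g=(0,1)$, $b=(-1,1)$. For $S\subseteq\{r,g,b\}$, $P_n(S)$ is the poset on this set whose order relation is the reflexive–transitive closure of the relations $u<u+v$ for all $u,u+v$ in the set and $v$ the vector of a color in $S$. For a poset $P$, $P^*$ denotes the dual poset, $J(P)$ the set of order ideals (down-closed subsets) of $P$, and $F(J(P),q)=\sum_{I\in J(P)}q^{|I|}$. *)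

theory Defs
  imports
    "HOL-Computational_Algebra.Polynomial"
    "HOL-Library.Product_Plus"
begin

datatype color = Red | Green | Blue

fun color_vec :: "color \<Rightarrow> int \<times> int" where
  "color_vec Red = (1, 0)"
| "color_vec Green = (0, 1)"
| "color_vec Blue = (-1, 1)"

text \<open>The bound \<open>n - 2\<close> is taken in the integers, so the set is empty for \<open>n = 1\<close>.\<close>

definition P_set :: "nat \<Rightarrow> (int \<times> int) set" where
  "P_set n = {(c1, c2). 0 \<le> c1 \<and> 0 \<le> c2 \<and> c1 + c2 \<le> int n - 2}"

definition P_step :: "nat \<Rightarrow> color set \<Rightarrow> (int \<times> int) rel" where
  "P_step n S = {(u, u + color_vec c) |u c. c \<in> S \<and> u \<in> P_set n \<and> u + color_vec c \<in> P_set n}"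

text \<open>As in \<^theory>\<open>HOL.Order_Relation\<close>, a poset is its reflexive order relation \<open>r\<close>, with underlying
  set \<open>Field r\<close>; the dual poset is the converse relation. The restriction is needed because
  \<^const>\<open>rtrancl\<close> is reflexive on the whole type.\<close>

definition P :: "nat \<Rightarrow> color set \<Rightarrow> (int \<times> int) rel" where
  "P n S = Restr ((P_step n S)\<^sup>*) (P_set n)"

text \<open>Despite its name, \<^const>\<open>ofilter\<close> means down-closed: with each element of the set, everything
  \<open>r\<close>-below it lies in the set.\<close>

definition J :: "'a rel \<Rightarrow> 'a set set" where
  "J r = {I. ofilter r I}"

text \<open>The indeterminate \<open>q\<close> is the polynomial variable, i.e. \<open>q ^ k\<close> is \<open>monom 1 k\<close>.\<close>

definition F :: "'a set set \<Rightarrow> int poly" where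
  "F \<J> = (\<Sum>I\<in>\<J>. monom 1 (card I))"

fun carlitz_riordan :: "nat \<Rightarrow> int poly" where
  "carlitz_riordan 0 = 1"
| "carlitz_riordan (Suc 0) = 1"
| "carlitz_riordan (Suc (Suc m)) =
    (\<Sum>k = 1..Suc (Suc m). monom 1 (k - 1) * carlitz_riordan (k - 1) * carlitz_riordan (Suc (Suc m) - k))"

lemma Field_P: "Field (P n S) = P_set n"
  by (auto simp: P_def Field_def)

lemma finite_P_set: "finite (P_set n)"
proof (rule finite_subset)
  show "P_set n \<subseteq> {0..int n} \<times> {0..int n}"
    by (auto simp: P_set_def)
qed simp

lemma finite_J_P: "finite (J (P n S))"
  by (rule finite_subset[of _ "Pow (P_set n)"]) (auto simp: J_def ofilter_def Field_P finite_P_set)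

lemma P_step_weight:
  assumes "(u, v) \<in> (P_step n S)\<^sup>*"
  shows "u = v \<or> fst u + 2 * snd u < fst v + 2 * snd v"
  using assms
proof (induction rule: rtrancl_induct)
  case (step y z)
  then obtain c where "z = y + color_vec c" by (auto simp: P_step_def)
  then have "fst y + 2 * snd y < fst z + 2 * snd z" by (cases c) auto
  with step show ?case by auto
qed simp

lemma Partial_order_P: "Partial_order (P n S)"
proof -
  have "refl_on (P_set n) (P n S)" "P n S \<subseteq> P_set n \<times> P_set n"
    by (auto simp: P_def refl_on_def)
  moreover have "trans (P n S)"
    by (auto simp: P_def trans_def)
  moreover have "antisym (P n S)"
    by (rule antisymI) (auto simp: P_def dest!: P_step_weight)
  ultimately show ?thesis
    by (simp add: partial_order_on_def preorder_on_def Field_P)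
qed

end

(* An ideal of P_n({b,g}) is determined by its column heights, read from right to left: these are
  the sequences of n - 1 naturals starting with a value at most 1 in which each term exceeds its
  predecessor by at most 1. Let B(n,m) count sequences of length n of this kind with first term at
  most m, by sum. Cutting such a sequence at its first zero gives
  B(n,m+1) = sum_k q^k B(k,m) B(n-k,0), and m = 0 is the Carlitz-Riordan recurrence because
  B(n+1,0) = B(n,1). At q = 1 the same numbers are the ballot numbers
  binom(2n+m,n) - binom(2n+m,n-1). Finally (c1,c2) -> (c1,n-2-c1-c2) is an isomorphism from
  P_n({b,g}) to the dual of P_n({r,g}), and complementation exchanges the ideals of a poset with
  those of its dual. *)
theory Submission
  imports Defs
begin

section \<open>Down-closed sets of a relation\<close>

text \<open>Order ideals expressed through a generating relation \<open>R\<close>, so that only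
  single steps have to be checked.\<close>

definition lower_sets :: "'a set \<Rightarrow> 'a rel \<Rightarrow> 'a set set" where
  "lower_sets A R = {I. I \<subseteq> A \<and> (\<forall>(u, v)\<in>R. v \<in> I \<longrightarrow> u \<in> I)}"

lemma finite_lower_sets: "finite A \<Longrightarrow> finite (lower_sets A R)"
  by (rule finite_subset[of _ "Pow A"]) (auto simp: lower_sets_def)

lemma P_step_subset: "P_step n S \<subseteq> P_set n \<times> P_set n"
  by (auto simp: P_step_def)

lemma P_step_subset_P: "P_step n S \<subseteq> P n S"
  using P_step_subset unfolding P_def by blast

text \<open>Membership in \<open>I\<close> propagates step by step down any chain of the
  reflexive-transitive closure.\<close>

lemma J_P: "J (P n S) = lower_sets (P_set n) (P_step n S)"
proof (intro equalityI subsetI)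
  fix I assume "I \<in> J (P n S)"
  then show "I \<in> lower_sets (P_set n) (P_step n S)"
    using P_step_subset_P[of n S] by (auto simp: J_def ofilter_def under_def lower_sets_def Field_P)
next
  fix I assume I: "I \<in> lower_sets (P_set n) (P_step n S)"
  have "u \<in> I" if "(u, v) \<in> (P_step n S)\<^sup>*" "v \<in> I" for u v
    using that by (induction rule: converse_rtrancl_induct) (use I in \<open>auto simp: lower_sets_def\<close>)
  with I show "I \<in> J (P n S)"
    by (auto simp: J_def ofilter_def under_def lower_sets_def Field_P) (auto simp: P_def)
qed

lemma J_converse_P: "J ((P n S)\<inverse>) = lower_sets (P_set n) ((P_step n S)\<inverse>)"
proof (intro equalityI subsetI)
  fix I assume "I \<in> J ((P n S)\<inverse>)"
  then show "I \<in> lower_sets (P_set n) ((P_step n S)\<inverse>)"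
    using P_step_subset_P[of n S] by (auto simp: J_def ofilter_def under_def lower_sets_def Field_P)
next
  fix I assume I: "I \<in> lower_sets (P_set n) ((P_step n S)\<inverse>)"
  have "v \<in> I" if "(u, v) \<in> (P_step n S)\<^sup>*" "u \<in> I" for u v
    using that by (induction rule: rtrancl_induct) (use I in \<open>auto simp: lower_sets_def\<close>)
  with I show "I \<in> J ((P n S)\<inverse>)"
    by (auto simp: J_def ofilter_def under_def lower_sets_def Field_P) (auto simp: P_def)
qed

text \<open>Taking images under \<open>f\<close> is a size-preserving bijection between the lower
  sets. This serves both changes of coordinates below.\<close>

lemma F_lower_sets_image:
  assumes f: "bij_betw f A B" and R: "R \<subseteq> A \<times> A"
  shows "F (lower_sets B (map_prod f f ` R)) = F (lower_sets A R)"
proof -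
  from f have inj: "inj_on f A" and B: "f ` A = B"
    by (auto simp: bij_betw_def)
  have mem_iff: "f ` I \<in> lower_sets B (map_prod f f ` R) \<longleftrightarrow> I \<in> lower_sets A R" if "I \<subseteq> A" for I
  proof -
    have "f u \<in> f ` I \<longleftrightarrow> u \<in> I" "f v \<in> f ` I \<longleftrightarrow> v \<in> I" if "(u, v) \<in> R" for u v
      using that R \<open>I \<subseteq> A\<close> inj_on_image_mem_iff[OF inj] by blast+
    then show ?thesis
      using \<open>I \<subseteq> A\<close> B unfolding lower_sets_def by fastforce
  qed
  have "lower_sets B (map_prod f f ` R) = (`) f ` lower_sets A R"
  proof (intro equalityI subsetI)
    fix K assume K: "K \<in> lower_sets B (map_prod f f ` R)"
    then have "K \<subseteq> f ` A" by (simp add: B lower_sets_def)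
    then obtain I where "I \<subseteq> A" "K = f ` I" by (auto simp: subset_image_iff)
    with K mem_iff show "K \<in> (`) f ` lower_sets A R" by blast
  next
    fix K assume "K \<in> (`) f ` lower_sets A R"
    then obtain I where "K = f ` I" "I \<in> lower_sets A R" by blast
    moreover from this have "I \<subseteq> A" by (simp add: lower_sets_def)
    ultimately show "K \<in> lower_sets B (map_prod f f ` R)"
      using mem_iff by blast
  qed
  moreover have "inj_on ((`) f) (lower_sets A R)"
    by (rule inj_on_subset[OF inj_on_image_Pow[OF inj]]) (auto simp: lower_sets_def)
  moreover have "card (f ` I) = card I" if "I \<in> lower_sets A R" for I
    using that by (intro card_image inj_on_subset[OF inj]) (simp add: lower_sets_def)
  ultimately show ?thesis
    by (simp add: F_def sum.reindex)
qed

text \<open>Complementation in \<open>A\<close> exchanges the two families. It does not preserve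
  sizes, so it compares their numbers but not \<open>F\<close>.\<close>

lemma card_lower_sets_converse:
  assumes "R \<subseteq> A \<times> A"
  shows "card (lower_sets A (R\<inverse>)) = card (lower_sets A R)"
  by (rule bij_betw_same_card[of "\<lambda>I. A - I"], rule bij_betw_byWitness[where f' = "\<lambda>I. A - I"])
    (use assms in \<open>auto simp: lower_sets_def\<close>)

section \<open>Ballot polynomials\<close>

fun ballot_poly :: "nat \<Rightarrow> nat \<Rightarrow> int poly" where
  "ballot_poly 0 m = 1"
| "ballot_poly (Suc n) m = (\<Sum>x\<le>m. monom 1 x * ballot_poly n (Suc x))"

text \<open>Here \<open>k\<close> is the number of terms before the first zero. These are positive,
  and lowering each by 1 gives the factor q^k B(k,m); the rest is empty or starts with 0.\<close>

lemma ballot_poly_Suc_right: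
  "ballot_poly n (Suc m) = (\<Sum>k\<le>n. monom 1 k * ballot_poly k m * ballot_poly (n - k) 0)"
proof (induction n arbitrary: m)
  case 0
  show ?case by simp
next
  case (Suc n)
  \<comment> \<open>The summand with first term 0 is split off: \<open>ballot_poly n 1\<close>
    equals \<open>ballot_poly (Suc n) 0\<close>, the \<open>k = 0\<close> term of the goal.\<close>
  have "ballot_poly (Suc n) (Suc m)
      = ballot_poly n 1 + (\<Sum>x\<le>m. monom 1 (Suc x) * ballot_poly n (Suc (Suc x)))"
    by (simp only: ballot_poly.simps sum.atMost_Suc_shift) simp
  also have "(\<Sum>x\<le>m. monom 1 (Suc x) * ballot_poly n (Suc (Suc x)))
      = (\<Sum>x\<le>m. \<Sum>k\<le>n. monom 1 (Suc k) * (monom 1 x * ballot_poly k (Suc x)) * ballot_poly (n - k) 0)"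
    by (simp add: Suc.IH sum_distrib_left mult_monom add.commute flip: mult.assoc)
  also have "\<dots> = (\<Sum>k\<le>n. monom 1 (Suc k) * ballot_poly (Suc k) m * ballot_poly (n - k) 0)"
    by (subst sum.swap) (simp add: sum_distrib_left sum_distrib_right)
  finally show ?case
    by (simp add: sum.atMost_Suc_shift del: sum.atMost_Suc)
qed

lemma carlitz_riordan_Suc:
  "carlitz_riordan (Suc n) = (\<Sum>k\<le>n. monom 1 k * carlitz_riordan k * carlitz_riordan (n - k))"
proof (cases n)
  case (Suc m)
  show ?thesis
    unfolding Suc carlitz_riordan.simps
    by (rule sum.reindex_bij_witness[of _ Suc "\<lambda>k. k - 1"]) auto
qed simp

lemma ballot_poly_0_right: "ballot_poly n 0 = carlitz_riordan n"
proof (induction n rule: less_induct)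
  case (less n)
  show ?case
  proof (cases n)
    case (Suc l)
    have "ballot_poly (Suc l) 0 = ballot_poly l (Suc 0)" by simp
    with less Suc show ?thesis
      by (simp add: ballot_poly_Suc_right carlitz_riordan_Suc del: ballot_poly.simps)
  qed simp
qed

text \<open>At q = 1, splitting off the largest first term gives B(n+1,m+1) = B(n+1,m) + B(n,m+2),
  which the difference of binomials satisfies by Pascal's rule. The length \<open>Suc n\<close>
  keeps the lower index n of the second binomial natural.\<close>

lemma poly_ballot_poly_1:
  "poly (ballot_poly (Suc n) m) 1 = int (2 * n + m + 2 choose Suc n) - int (2 * n + m + 2 choose n)"
proof (induction n arbitrary: m)
  case 0
  show ?case by (simp add: poly_sum poly_monom)
next
  case (Suc n)
  \<comment> \<open>The boundary case m = 0 needs, besides Pascal's rule, the equality of the two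
    middle binomials.\<close>
  have sym: "2 * n + 3 choose Suc (Suc n) = 2 * n + 3 choose Suc n"
    by (subst binomial_symmetric) auto
  show ?case
  proof (induction m)
    case 0
    have "poly (ballot_poly (Suc (Suc n)) 0) 1 = poly (ballot_poly (Suc n) 1) 1"
      by simp
    also have "\<dots> = int (2 * n + 3 choose Suc n) - int (2 * n + 3 choose n)"
      by (simp only: Suc.IH) (simp add: numeral_eq_Suc)
    finally show ?case
      using sym by (simp add: numeral_eq_Suc del: ballot_poly.simps)
  next
    case (Suc m)
    have "poly (ballot_poly (Suc (Suc n)) (Suc m)) 1
        = poly (ballot_poly (Suc (Suc n)) m) 1 + poly (ballot_poly (Suc n) (Suc (Suc m))) 1"
      by (subst (1 2) ballot_poly.simps(2)) (simp add: poly_monom del: ballot_poly.simps)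
    also have "\<dots> = int (2 * Suc n + m + 2 choose Suc (Suc n)) - int (2 * Suc n + m + 2 choose Suc n)
        + (int (2 * n + Suc (Suc m) + 2 choose Suc n) - int (2 * n + Suc (Suc m) + 2 choose n))"
      by (simp only: Suc.IH \<open>\<And>m. poly (ballot_poly (Suc n) m) 1 = _ m\<close>)
    finally show ?case
      by (simp add: numeral_eq_Suc del: ballot_poly.simps)
  qed
qed

lemma poly_ballot_poly_0_1:
  "real_of_int (poly (ballot_poly n 0) 1) = 1 / (real n + 1) * real (2 * n choose n)"
proof (cases n)
  case (Suc l)
  \<comment> \<open>Both sides equal (2l+2) binom(2l+1,l).\<close>
  have "Suc (Suc l) * (2 * Suc l choose l) = Suc l * (2 * Suc l choose Suc l)"
    using binomial_absorb_comp[of "2 * Suc l" l] binomial_absorption[of l "2 * Suc l"] by simp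
  then have "real (l + 2) * real (2 * Suc l choose l) = real (l + 1) * real (2 * Suc l choose Suc l)"
    by (simp only: flip: of_nat_mult) simp
  then show ?thesis
    unfolding Suc poly_ballot_poly_1 by (simp add: field_simps)
qed simp

section \<open>Trapezoids\<close>

text \<open>Column \<open>i\<close> has \<open>m + i\<close> cells, the largest value that term
  \<open>i\<close> of a sequence counted by B(n,m) can take.\<close>

definition trapezoid :: "nat \<Rightarrow> nat \<Rightarrow> (nat \<times> nat) set" where
  "trapezoid n m = {(i, j). i < n \<and> j < m + i}"

text \<open>Vertical steps make each column of a lower set an initial segment; diagonal steps let a
  height exceed the previous one by at most 1.\<close>

definition trapezoid_step :: "nat \<Rightarrow> nat \<Rightarrow> (nat \<times> nat) rel" where
  "trapezoid_step n m = Restr ({((i, j), (i, Suc j)) |i j. True} \<union> {((i, j), (Suc i, Suc j)) |i j. True})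
    (trapezoid n m)"

lemma finite_trapezoid: "finite (trapezoid n m)"
  by (rule finite_subset[of _ "{..<n} \<times> {..<m + n}"]) (auto simp: trapezoid_def)

lemma lower_sets_trapezoid:
  "I \<in> lower_sets (trapezoid n m) (trapezoid_step n m) \<longleftrightarrow>
    (\<forall>i j. (i, j) \<in> I \<longrightarrow> i < n \<and> j < m + i) \<and>
    (\<forall>i j. (i, Suc j) \<in> I \<longrightarrow> (i, j) \<in> I) \<and> (\<forall>i j. (Suc i, Suc j) \<in> I \<longrightarrow> (i, j) \<in> I)"
proof -
  have "I \<in> lower_sets (trapezoid n m) (trapezoid_step n m) \<longleftrightarrow> I \<subseteq> trapezoid n m \<and>
      (\<forall>i j. (i, j) \<in> trapezoid n m \<longrightarrow> (i, Suc j) \<in> I \<longrightarrow> (i, j) \<in> I) \<and>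
      (\<forall>i j. (i, j) \<in> trapezoid n m \<longrightarrow> (Suc i, Suc j) \<in> I \<longrightarrow> (i, j) \<in> I)"
    unfolding lower_sets_def trapezoid_step_def by blast
  moreover have "(i, j) \<in> trapezoid n m"
    if "(i, Suc j) \<in> trapezoid n m \<or> (Suc i, Suc j) \<in> trapezoid n m" for i j
    using that by (auto simp: trapezoid_def)
  moreover have "I \<subseteq> trapezoid n m \<longleftrightarrow> (\<forall>i j. (i, j) \<in> I \<longrightarrow> i < n \<and> j < m + i)"
    by (auto simp: trapezoid_def)
  ultimately show ?thesis by blast
qed

section \<open>Splitting off the first column of a trapezoid\<close>

definition cons_column :: "nat \<Rightarrow> (nat \<times> nat) set \<Rightarrow> (nat \<times> nat) set" where
  "cons_column x K = {0} \<times> {..<x} \<union> map_prod Suc id ` K"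

lemma cons_column_simps [simp]:
  "(0, j) \<in> cons_column x K \<longleftrightarrow> j < x"
  "(Suc i, j) \<in> cons_column x K \<longleftrightarrow> (i, j) \<in> K"
  by (force simp: cons_column_def)+

lemma card_cons_column:
  assumes "finite K"
  shows "card (cons_column x K) = x + card K"
proof -
  have "card (cons_column x K) = card ({0::nat} \<times> {..<x}) + card (map_prod Suc id ` K)"
    unfolding cons_column_def using assms by (intro card_Un_disjoint) auto
  also have "card (map_prod Suc id ` K) = card K"
    by (rule card_image) (auto simp: inj_on_def)
  finally show ?thesis by (simp add: card_cartesian_product)
qed

lemma cons_column_in_lower_sets:
  "cons_column x K \<in> lower_sets (trapezoid (Suc n) m) (trapezoid_step (Suc n) m) \<longleftrightarrow>
    x \<le> m \<and> K \<in> lower_sets (trapezoid n (Suc x)) (trapezoid_step n (Suc x))"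
  (is "?lhs \<longleftrightarrow> ?rhs")
proof
  assume lhs: ?lhs
  then have bound: "(i, j) \<in> cons_column x K \<Longrightarrow> i < Suc n \<and> j < m + i"
    and down: "(i, Suc j) \<in> cons_column x K \<Longrightarrow> (i, j) \<in> cons_column x K"
    and diag: "(Suc i, Suc j) \<in> cons_column x K \<Longrightarrow> (i, j) \<in> cons_column x K" for i j
    unfolding lower_sets_trapezoid by blast+
  have "x \<le> m"
  proof (rule ccontr)
    assume "\<not> x \<le> m"
    then have "(0, m) \<in> cons_column x K" by simp
    from bound[OF this] show False by simp
  qed
  \<comment> \<open>Descending diagonally from a cell of \<open>K\<close> leads to the new first
    column, whose height is \<open>x\<close>.\<close>
  moreover have "j < Suc x + i" if "(i, j) \<in> K" for i j
    using that
  proof (induction i arbitrary: j)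
    case 0
    then show ?case using diag[of 0 "j - 1"] by (cases j) auto
  next
    case (Suc i)
    show ?case
    proof (cases j)
      case (Suc k)
      with Suc.prems have "(i, k) \<in> K" using diag[of "Suc i" k] by simp
      from Suc.IH[OF this] Suc show ?thesis by simp
    qed simp
  qed
  moreover have "i < n" if "(i, j) \<in> K" for i j
    using bound[of "Suc i" j] that by simp
  moreover have "(i, j) \<in> K" if "(i, Suc j) \<in> K" for i j
    using down[of "Suc i" j] that by simp
  moreover have "(i, j) \<in> K" if "(Suc i, Suc j) \<in> K" for i j
    using diag[of "Suc i" j] that by simp
  ultimately show ?rhs
    unfolding lower_sets_trapezoid by blast
next
  assume rhs: ?rhs
  then have x: "x \<le> m" by simp
  from rhs have bound: "(i, j) \<in> K \<Longrightarrow> i < n \<and> j < Suc x + i"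
    and down: "(i, Suc j) \<in> K \<Longrightarrow> (i, j) \<in> K"
    and diag: "(Suc i, Suc j) \<in> K \<Longrightarrow> (i, j) \<in> K" for i j
    unfolding lower_sets_trapezoid by blast+
  have "i < Suc n \<and> j < m + i" if "(i, j) \<in> cons_column x K" for i j
    using that x bound[of "i - 1" j] by (cases i) auto
  moreover have "(i, j) \<in> cons_column x K" if "(i, Suc j) \<in> cons_column x K" for i j
    using that down[of "i - 1" j] by (cases i) auto
  moreover have "(i, j) \<in> cons_column x K" if "(Suc i, Suc j) \<in> cons_column x K" for i j
    using that diag[of "i - 1" j] bound[of 0 "Suc j"] by (cases i) auto
  ultimately show ?lhs
    unfolding lower_sets_trapezoid by blast
qed

lemma down_closed_nat_eq:
  fixes A :: "nat set"
  assumes "finite A" and down: "\<And>j. Suc j \<in> A \<Longrightarrow> j \<in> A"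
  shows "A = {..<card A}"
proof -
  have *: "j \<in> A" if "j \<le> k" "k \<in> A" for j k
    using that by (induction rule: inc_induct) (blast intro: down)+
  have "\<exists>x. x \<notin> A"
    using \<open>finite A\<close> ex_new_if_finite infinite_UNIV_nat by blast
  then have "(LEAST x. x \<notin> A) \<notin> A" by (rule LeastI_ex)
  then have "A = {..<LEAST x. x \<notin> A}"
    using * by (meson lessThan_iff not_le not_less_Least set_eqI)
  then show ?thesis by (metis card_lessThan)
qed

text \<open>The first column is an initial segment, hence determined by its size; so every lower set
  arises by prepending a column.\<close>

lemma lower_set_trapezoid_eq_cons_column:
  assumes "I \<in> lower_sets (trapezoid n m) (trapezoid_step n m)"
  shows "cons_column (card {j. (0, j) \<in> I}) {(i, j). (Suc i, j) \<in> I} = I"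
proof -
  let ?A = "{j. (0, j) \<in> I}"
  have "?A \<subseteq> {..<m}"
  proof
    fix j assume "j \<in> ?A"
    with assms have "j < m + 0" unfolding lower_sets_trapezoid by blast
    then show "j \<in> {..<m}" by simp
  qed
  then have "finite ?A" by (rule finite_subset) simp
  moreover have "j \<in> ?A" if "Suc j \<in> ?A" for j
    using assms that unfolding lower_sets_trapezoid by blast
  ultimately have "?A = {..<card ?A}" by (rule down_closed_nat_eq)
  then have "j < card ?A \<longleftrightarrow> (0, j) \<in> I" for j by blast
  then have "(i, j) \<in> cons_column (card ?A) {(i, j). (Suc i, j) \<in> I} \<longleftrightarrow> (i, j) \<in> I" for i j
    by (cases i) (simp_all only: cons_column_simps mem_Collect_eq case_prod_conv)
  then show ?thesis by (intro set_eqI) auto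
qed

text \<open>The pair of first height \<open>x\<close> and remaining columns turns the sum over lower
  sets into the recursion of \<open>ballot_poly\<close>; \<open>m\<close> varies because the
  remaining trapezoid has parameter \<open>Suc x\<close>.\<close>

lemma F_lower_sets_trapezoid:
  "F (lower_sets (trapezoid n m) (trapezoid_step n m)) = ballot_poly n m"
proof (induction n arbitrary: m)
  case 0
  have "lower_sets (trapezoid 0 m) (trapezoid_step 0 m) = {{}}"
    by (auto simp: lower_sets_def trapezoid_def trapezoid_step_def)
  then show ?case by (simp add: F_def)
next
  case (Suc n)
  let ?L = "\<lambda>n m. lower_sets (trapezoid n m) (trapezoid_step n m)"
  have fin: "finite I" if "I \<in> ?L n m" for I n m
    using that finite_trapezoid by (auto simp: lower_sets_def intro: finite_subset)
  let ?x = "\<lambda>I. card {j. (0, j) \<in> I}" and ?K = "\<lambda>I. {(i, j). (Suc i, j) \<in> I}"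
  have decomp: "?x I \<le> m" "?K I \<in> ?L n (Suc (?x I))" if "I \<in> ?L (Suc n) m" for I
  proof -
    have "cons_column (?x I) (?K I) \<in> ?L (Suc n) m"
      using that by (simp only: lower_set_trapezoid_eq_cons_column)
    then show "?x I \<le> m" "?K I \<in> ?L n (Suc (?x I))"
      by (simp_all only: cons_column_in_lower_sets)
  qed
  have "F (?L (Suc n) m) = (\<Sum>(x, K)\<in>(SIGMA x:{..m}. ?L n (Suc x)). monom 1 (x + card K))"
    unfolding F_def
  proof (rule sum.reindex_bij_witness[of _ "\<lambda>(x, K). cons_column x K"
        "\<lambda>I. (?x I, ?K I)"], goal_cases)
    case (1 I)
    then show ?case by (simp add: lower_set_trapezoid_eq_cons_column)
  next
    case (2 I)
    then show ?case by (simp add: decomp)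
  next
    case (3 y)
    then show ?case by (auto simp flip: lessThan_def)
  next
    case (4 y)
    then show ?case by (auto simp: cons_column_in_lower_sets)
  next
    case (5 I)
    have "card (cons_column (?x I) (?K I)) = ?x I + card (?K I)"
      using decomp(2)[OF 5] by (intro card_cons_column fin)
    then show ?case by (simp add: lower_set_trapezoid_eq_cons_column[OF 5])
  qed
  also have "\<dots> = (\<Sum>x\<le>m. \<Sum>K\<in>?L n (Suc x). monom 1 (x + card K))"
    by (rule sum.Sigma[symmetric]) (auto intro: finite_lower_sets finite_trapezoid)
  also have "\<dots> = (\<Sum>x\<le>m. monom 1 x * F (?L n (Suc x)))"
    by (simp add: F_def sum_distrib_left mult_monom)
  finally show ?case by (simp add: Suc.IH)
qed

section \<open>The two posets\<close>

lemma P_step_iff: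
  "(u, v) \<in> P_step n S \<longleftrightarrow> u \<in> P_set n \<and> v \<in> P_set n \<and> (\<exists>c\<in>S. v = u + color_vec c)"
  unfolding P_step_def by blast

lemma F_J_Blue_Green:
  assumes "n \<ge> 1"
  shows "F (J (P n {Blue, Green})) = carlitz_riordan n"
proof -
  from assms obtain l where n: "n = Suc l" by (cases n) auto
  \<comment> \<open>Columns are read from right to left, so column \<open>i\<close> has
    \<open>i + 1\<close> cells. Green becomes the vertical step and Blue the diagonal one.\<close>
  let ?f = "\<lambda>(i, j). (int n - 2 - int i, int j)"
  have bij: "bij_betw ?f (trapezoid l 1) (P_set n)"
    by (rule bij_betw_byWitness[where f' = "\<lambda>(a, b). (nat (int n - 2 - a), nat b)"])
      (auto simp: trapezoid_def P_set_def n)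
  have "P_step n {Blue, Green} = map_prod ?f ?f ` trapezoid_step l 1"
  proof (intro equalityI subrelI)
    fix u v assume uv: "(u, v) \<in> P_step n {Blue, Green}"
    obtain a b a' b' where [simp]: "u = (a, b)" "v = (a', b')" by (cases u, cases v)
    have "((nat (int n - 2 - a), nat b), (nat (int n - 2 - a'), nat b')) \<in> trapezoid_step l 1"
      using uv by (auto simp: P_step_iff trapezoid_step_def trapezoid_def P_set_def n)
    moreover have "(u, v) = map_prod ?f ?f ((nat (int n - 2 - a), nat b), (nat (int n - 2 - a'), nat b'))"
      using uv by (auto simp: P_step_iff P_set_def)
    ultimately show "(u, v) \<in> map_prod ?f ?f ` trapezoid_step l 1" by blast
  next
    fix u v assume "(u, v) \<in> map_prod ?f ?f ` trapezoid_step l 1"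
    then show "(u, v) \<in> P_step n {Blue, Green}"
      by (auto simp: trapezoid_step_def trapezoid_def P_step_iff P_set_def n)
  qed
  with F_lower_sets_image[OF bij, of "trapezoid_step l 1"]
  have "F (J (P n {Blue, Green})) = ballot_poly l 1"
    by (simp add: J_P F_lower_sets_trapezoid[symmetric] trapezoid_step_def)
  \<comment> \<open>Prepending a zero to the sequence of heights lowers the starting bound from 1 to
    0.\<close>
  also have "\<dots> = ballot_poly n 0" by (simp add: n)
  finally show ?thesis by (simp add: ballot_poly_0_right)
qed

lemma F_J_Blue_Green_eq_dual_Red_Green:
  "F (J (P n {Blue, Green})) = F (J ((P n {Red, Green})\<inverse>))"
proof -
  \<comment> \<open>This involution replaces the second coordinate by the slack in c1 + c2 <= n - 2.
    It turns Blue into reversed Red and Green into reversed Green.\<close>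
  let ?f = "\<lambda>(a, b). (a, int n - 2 - a - b)"
  have bij: "bij_betw ?f (P_set n) (P_set n)"
    by (rule bij_betw_byWitness[where f' = ?f]) (auto simp: P_set_def)
  have "(P_step n {Red, Green})\<inverse> = map_prod ?f ?f ` P_step n {Blue, Green}"
  proof (intro equalityI subrelI)
    fix u v assume uv: "(u, v) \<in> (P_step n {Red, Green})\<inverse>"
    then have "(?f u, ?f v) \<in> P_step n {Blue, Green}"
      by (cases u, cases v) (auto simp: P_step_iff P_set_def)
    moreover have "(u, v) = map_prod ?f ?f (?f u, ?f v)"
      by (simp add: case_prod_beta)
    ultimately show "(u, v) \<in> map_prod ?f ?f ` P_step n {Blue, Green}" by blast
  next
    fix u v assume "(u, v) \<in> map_prod ?f ?f ` P_step n {Blue, Green}"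
    then show "(u, v) \<in> (P_step n {Red, Green})\<inverse>"
      by (cases u, cases v) (auto simp: P_step_iff P_set_def)
  qed
  then show ?thesis
    unfolding J_P J_converse_P by (simp add: F_lower_sets_image[OF bij P_step_subset])
qed

section \<open>From generating polynomials to cardinalities\<close>

lemma poly_F_1: "finite A \<Longrightarrow> poly (F A) 1 = int (card A)"
  by (simp add: F_def poly_sum poly_monom)

theorem theorem2p2:
  fixes n :: nat
  assumes "n \<ge> 1"
  shows "card (J (P n {Blue, Green})) = card (J (P n {Red, Green}))
    \<and> real (card (J (P n {Red, Green}))) = 1 / (real n + 1) * real (2 * n choose n)
    \<and> F (J (P n {Blue, Green})) = F (J ((P n {Red, Green})\<inverse>))
    \<and> F (J ((P n {Red, Green})\<inverse>)) = carlitz_riordan n"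
proof -
  note F_eq = F_J_Blue_Green_eq_dual_Red_Green[of n]
  have finite_dual: "finite (J ((P n {Red, Green})\<inverse>))"
    by (simp add: J_converse_P finite_lower_sets finite_P_set)
  have "card (J (P n {Red, Green})) = card (J ((P n {Red, Green})\<inverse>))"
    unfolding J_P J_converse_P by (rule card_lower_sets_converse[OF P_step_subset, symmetric])
  \<comment> \<open>The equality of generating polynomials is evaluated at q = 1.\<close>
  also have "\<dots> = card (J (P n {Blue, Green}))"
    using F_eq poly_F_1[OF finite_dual] poly_F_1[OF finite_J_P[of n "{Blue, Green}"]] by simp
  finally have card_eq: "card (J (P n {Blue, Green})) = card (J (P n {Red, Green}))" ..
  have "real (card (J (P n {Blue, Green}))) = real_of_int (poly (F (J (P n {Blue, Green}))) 1)"
    by (simp add: poly_F_1 finite_J_P)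
  also have "\<dots> = 1 / (real n + 1) * real (2 * n choose n)"
    using poly_ballot_poly_0_1[of n] by (simp only: F_J_Blue_Green[OF assms] ballot_poly_0_right)
  finally show ?thesis
    using F_J_Blue_Green[OF assms] F_eq card_eq by simp
qed

end
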